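(* Let $n \geq d \geq 1$ be integers and let $\sigma, B > 0$. The soft thresholded ordinary least squares estimator $\hat\theta^{\mathsf{STOLS}}_\eta$ satisfies the following. (a) Let $p \in (0,1]$ and $R > 0$, and put $\tau_n = \sqrt{\frac{\sigma^2 B}{R^2 n}}$. If $\tau_n^2 \in \left[ d^{-2/p}, \frac{1}{\log(e d)} \right]$, then with the choice $\eta = \sqrt{2 R^2 \tau_n^2 \log(e d \tau_n^p)}$, $$\sup_{X \in \mathcal{X}_{n,d}(B)} \ \sup_{\|\theta^\star\|_p \leq R} \mathbf{E}\left[ \left\| \hat\theta^{\mathsf{STOLS}}_\eta(X,y) - \theta^\star \right\|_2^2 \right] \leq 6\, R^2 \left( \tau_n^2 \log(e d \tau_n^p) \right)^{1-p/2}.$$ (b) Let $s \in \{1,\dots,d\}$. With the choice $\eta = \sqrt{2 \frac{\sigma^2 B}{n} \log\left(\frac{e d}{s}\right)}$, $$\sup_{X \in \mathcal{X}_{n,d}(B)} \ \sup_{\|\theta^\star\|_0 \leq s} \mathbf{E}\left[ \left\| \hat\theta^{\mathsf{STOLS}}_\eta(X,y) - \theta^\star \right\|_2^2 \right] \leq 6\, \frac{\sigma^2 B}{n}\, s \log\left( e \frac{d}{s} \right).$$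
   Context: For $\theta \in \mathbb{R}^d$ and $p \in (0,1]$, $\|\theta\|_p = \left(\sum_{i=1}^d |\theta_i|^p\right)^{1/p}$, and $\|\theta\|_0$ is the number of nonzero coordinates of $\theta$. The class of design matrices is $\mathcal{X}_{n,d}(B) = \left\{ X \in \mathbb{R}^{n\times d} : \tfrac{1}{n} X^{T} X \succeq \tfrac{1}{B} I_d \right\}$, where $\succeq$ is the positive semidefinite order. Expectations are over $y \sim \mathsf{N}(X\theta^\star, \sigma^2 I_n)$ with $\theta^\star\in\mathbb{R}^d$. For $v \in \mathbb{R}^d$ and $\eta > 0$ the soft thresholding operator is $$\mathsf{S}_\eta(v) = \operatorname*{arg\,min}_{u \in \mathbb{R}^d} \left\{ \|u - v\|_2^2 + 2\eta \|u\|_1 \right\}.$$ The ordinary least squares estimate is $\hat\theta^{\mathsf{OLS}}(X,y) = (X^T X)^{-1} X^T y$, and the soft thresholded ordinary least squares estimator is $\hat\theta^{\mathsf{STOLS}}_\eta(X,y) = \mathsf{S}_\eta\left(\hat\theta^{\mathsf{OLS}}(X,y)\right)$. *)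

theory Defs
  imports "HOL-Probability.Probability"
begin

definition psd :: "real^'d^'d \<Rightarrow> bool" where
  "psd A \<longleftrightarrow> transpose A = A \<and> (\<forall>v. 0 \<le> v \<bullet> (A *v v))"

definition loewner_le :: "real^'d^'d \<Rightarrow> real^'d^'d \<Rightarrow> bool" where
  "loewner_le A B \<longleftrightarrow> psd (B - A)"

definition design_class :: "real \<Rightarrow> (real^'d^'n) set" where
  "design_class B =
     {X. loewner_le ((1 / B) *\<^sub>R mat 1) ((1 / real CARD('n)) *\<^sub>R (transpose X ** X))}"

definition lp_norm :: "real \<Rightarrow> real^'d \<Rightarrow> real" where
  "lp_norm p \<theta> = (\<Sum>i\<in>UNIV. \<bar>\<theta> $ i\<bar> powr p) powr (1 / p)"

definition l0_norm :: "real^'d \<Rightarrow> nat" where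
  "l0_norm \<theta> = card {i. \<theta> $ i \<noteq> 0}"

definition soft_threshold :: "real \<Rightarrow> real^'d \<Rightarrow> real^'d" where
  "soft_threshold \<eta> v = arg_min (\<lambda>u. (norm (u - v))\<^sup>2 + 2 * \<eta> * lp_norm 1 u) (\<lambda>_. True)"

definition ols :: "real^'d^'n \<Rightarrow> real^'n \<Rightarrow> real^'d" where
  "ols X y = (matrix_inv (transpose X ** X) ** transpose X) *v y"

definition stols :: "real \<Rightarrow> real^'d^'n \<Rightarrow> real^'n \<Rightarrow> real^'d" where
  "stols \<eta> X y = soft_threshold \<eta> (ols X y)"

text \<open>The law $N(\mu, \sigma^2 I)$, for $\sigma > 0$: the coordinates are independent, the
  \<open>i\<close>-th one normal with mean \<open>\<mu> $ i\<close> and standard deviation (not variance) \<open>\<sigma>\<close>.\<close>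

definition isotropic_normal :: "real^'n \<Rightarrow> real \<Rightarrow> (real^'n) measure" where
  "isotropic_normal \<mu> \<sigma> =
     distr (\<Pi>\<^sub>M i\<in>UNIV. density lborel (normal_density (\<mu> $ i) \<sigma>)) borel (\<lambda>f. \<chi> i. f i)"

lemma measurable_vec_lambda_PiM:
  "(\<lambda>f. \<chi> i. f i) \<in> (\<Pi>\<^sub>M i\<in>UNIV. density lborel (normal_density (\<mu> $ i) \<sigma>))
     \<rightarrow>\<^sub>M (borel :: (real^'n) measure)"
proof (rule borel_measurable_euclidean_space[THEN iffD2], intro ballI)
  fix b :: "real^'n" assume "b \<in> Basis"
  then obtain i where b: "b = axis i 1" by (auto simp: Basis_vec_def)
  have "(\<lambda>f. f i) \<in> (\<Pi>\<^sub>M i\<in>UNIV. density lborel (normal_density (\<mu> $ i) \<sigma>))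
     \<rightarrow>\<^sub>M density lborel (normal_density (\<mu> $ i) \<sigma>)"
    by (rule measurable_component_singleton) simp
  then show "(\<lambda>f. (\<chi> i. f i) \<bullet> b) \<in> borel_measurable
      (\<Pi>\<^sub>M i\<in>UNIV. density lborel (normal_density (\<mu> $ i) \<sigma>))"
    by (simp add: b inner_axis cong: measurable_cong_sets)
qed

lemma prob_space_isotropic_normal:
  assumes "\<sigma> > 0"
  shows "prob_space (isotropic_normal \<mu> \<sigma>)"
  unfolding isotropic_normal_def
  by (intro prob_space.prob_space_distr measurable_vec_lambda_PiM prob_space_PiM
      prob_space_normal_density assms)

text \<open>The expectation is a nonnegative integral, so that an infinite risk would count as infinite
  rather than as \<open>0\<close>.\<close>

definition risk :: "real \<Rightarrow> (real^'d^'n \<Rightarrow> real^'n \<Rightarrow> real^'d) \<Rightarrow> real^'d^'n \<Rightarrow> real^'d \<Rightarrow> ennreal" where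
  "risk \<sigma> est X \<theta> =
     (\<integral>\<^sup>+ y. ennreal ((norm (est X y - \<theta>))\<^sup>2) \<partial>isotropic_normal (X *v \<theta>) \<sigma>)"

end

theory Submission
  imports Defs
begin

text \<open>
  Write \<open>\<nu>\<^sup>2 = \<sigma>\<^sup>2 * B / n\<close>. Ordinary least squares is unbiased, and each of its coordinates is a linear
  functional of the observation, hence normal; the lower bound on \<open>X\<^sup>T X / n\<close> that defines the design
  class forces its variance to be at most \<open>\<nu>\<^sup>2\<close> (\<open>ols_linear_functional\<close>,
  \<open>nn_integral_linear_functional_isotropic_normal\<close>). Soft thresholding acts on each coordinate
  separately (\<open>soft_threshold_nth\<close>), and the squared error is a sum over the coordinates. So the risk
  is a sum of risks of one-dimensional problems, however the coordinates of the least squares estimate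
  depend on each other.

  The heart of the proof is the one-dimensional bound \<open>shrink_risk\<close>: for a threshold with
  \<open>\<eta>\<^sup>2 \<ge> 2 * \<nu>\<^sup>2\<close>, the risk at \<open>\<theta>\<close> is at most
  \<open>4 * \<nu>\<^sup>2 * exp (- \<eta>\<^sup>2 / (2 * \<nu>\<^sup>2)) + 2 * min (\<theta>\<^sup>2) (\<eta>\<^sup>2)\<close>. A large \<open>\<theta>\<close> costs at most the variance
  plus the squared bias \<open>\<eta>\<^sup>2\<close> of the threshold. For a small \<open>\<theta>\<close> the error is, up to \<open>\<theta>\<close> itself, the
  part of the noise that survives thresholding, and a Chernoff bound makes its second moment small.

  Summing over the coordinates leaves two terms. Both prescribed thresholds have the form
  \<open>\<eta>\<^sup>2 = 2 * \<nu>\<^sup>2 * L\<close> with \<open>L \<ge> 1\<close>, where \<open>exp (- L)\<close> is the inverse of \<open>e d \<tau>\<^sup>p\<close> or of \<open>e d / s\<close>, which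
  cancels the factor \<open>d\<close> in the noise term \<open>4 * d * \<nu>\<^sup>2 * exp (- L)\<close>. The signal term
  \<open>\<Sum>i. min (\<theta>\<^sub>i\<^sup>2) (\<eta>\<^sup>2)\<close> is at most \<open>R\<^sup>p * \<eta>\<^bsup>2 - p\<^esup>\<close> on an \<open>\<ell>\<^sub>p\<close> ball and at most \<open>s * \<eta>\<^sup>2\<close> on
  \<open>s\<close>-sparse vectors. In units of the claimed rate, the noise contributes at most \<open>4 / e \<le> 2\<close> and the
  signal at most \<open>4\<close>, which gives the constant \<open>6\<close>.
\<close>

section \<open>Soft thresholding coordinate by coordinate\<close>

text \<open>
  Scalar soft thresholding \<open>sgn x * max (\<bar>x\<bar> - \<eta>) 0\<close>, written as \<open>x\<close> minus its projection onto
  \<open>[- \<eta>, \<eta>]\<close>: the error analysis uses that this projection is bounded and monotone.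
\<close>

definition shrink :: "real \<Rightarrow> real \<Rightarrow> real" where
  "shrink \<eta> x = x - max (- \<eta>) (min \<eta> x)"

lemma continuous_on_shrink: "continuous_on A (shrink \<eta>)"
  unfolding shrink_def [abs_def] by (intro continuous_intros)

lemma borel_measurable_shrink [measurable]: "shrink \<eta> \<in> borel_measurable borel"
  by (intro borel_measurable_continuous_onI continuous_on_shrink)

text \<open>
  The projection \<open>c\<close> of \<open>v\<close> onto \<open>[- \<eta>, \<eta>]\<close> is a subgradient of \<open>\<eta> * \<bar>x\<bar>\<close> at \<open>x = v - c\<close>. The quadratic
  gap comes from the strong convexity of the objective and yields the uniqueness of the minimiser.
\<close>

lemma shrink_objective_gap:
  fixes u v :: real
  assumes "0 \<le> \<eta>"
  shows "(shrink \<eta> v - v)\<^sup>2 + 2 * \<eta> * \<bar>shrink \<eta> v\<bar> + (u - shrink \<eta> v)\<^sup>2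
         \<le> (u - v)\<^sup>2 + 2 * \<eta> * \<bar>u\<bar>"
proof -
  define c where "c = max (- \<eta>) (min \<eta> v)"
  have s: "shrink \<eta> v = v - c"
    by (simp add: shrink_def c_def)
  have "\<bar>c\<bar> \<le> \<eta>"
    using assms by (auto simp: c_def)
  then have "\<bar>c * u\<bar> \<le> \<eta> * \<bar>u\<bar>"
    by (simp add: abs_mult mult_right_mono)
  then have "c * u \<le> \<eta> * \<bar>u\<bar>"
    by linarith
  moreover have "c * (v - c) = \<eta> * \<bar>v - c\<bar>"
    using assms by (auto simp: c_def max_def min_def abs_if algebra_simps)
  ultimately show ?thesis
    unfolding s by (simp add: power2_eq_square algebra_simps)
qed

lemma lp_norm_one: "lp_norm 1 u = (\<Sum>i\<in>UNIV. \<bar>u $ i\<bar>)"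
  by (simp add: lp_norm_def sum_nonneg)

lemma norm_squared_sum: "(norm (u :: real^'k))\<^sup>2 = (\<Sum>i\<in>UNIV. (u $ i)\<^sup>2)"
  by (simp add: norm_vec_def L2_set_def sum_nonneg)

text \<open>
  The \<open>\<ell>\<^sub>1\<close>-penalised objective splits over the coordinates. Since \<^const>\<open>arg_min\<close> picks an arbitrary
  minimiser, identifying it requires that no other vector attains the minimum.
\<close>

lemma soft_threshold_nth:
  fixes v :: "real^'k"
  assumes "0 \<le> \<eta>"
  shows "soft_threshold \<eta> v $ i = shrink \<eta> (v $ i)"
proof -
  define f where "f = (\<lambda>u :: real^'k. (norm (u - v))\<^sup>2 + 2 * \<eta> * lp_norm 1 u)"
  define s where "s = (\<chi> i. shrink \<eta> (v $ i))"
  have f: "f u = (\<Sum>i\<in>UNIV. (u $ i - v $ i)\<^sup>2 + 2 * \<eta> * \<bar>u $ i\<bar>)" for u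
    by (simp add: f_def lp_norm_one norm_squared_sum sum.distrib sum_distrib_left)
  have gap: "f s + (norm (u - s))\<^sup>2 \<le> f u" for u
  proof -
    have "f s + (norm (u - s))\<^sup>2
          = (\<Sum>i\<in>UNIV. (s $ i - v $ i)\<^sup>2 + 2 * \<eta> * \<bar>s $ i\<bar> + (u $ i - s $ i)\<^sup>2)"
      by (simp add: f norm_squared_sum sum.distrib)
    also have "\<dots> \<le> f u"
      unfolding f s_def by (intro sum_mono) (simp add: shrink_objective_gap assms)
    finally show ?thesis .
  qed
  have min: "f s \<le> f u" for u
    using gap[of u] zero_le_power2[of "norm (u - s)"] by linarith
  have "f (arg_min f (\<lambda>_. True)) = f s"
    by (rule arg_min_equality) (auto intro: min)
  then have "(norm (arg_min f (\<lambda>_. True) - s))\<^sup>2 \<le> 0"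
    using gap[of "arg_min f (\<lambda>_. True)"] by linarith
  then have "arg_min f (\<lambda>_. True) = s"
    by simp
  then show ?thesis
    by (simp add: soft_threshold_def f_def s_def)
qed

section \<open>Least squares over the design class\<close>

lemma design_class_lower_bound:
  fixes X :: "real^'d^'n"
  assumes "X \<in> design_class B"
  shows "(norm u)\<^sup>2 / B \<le> (norm (X *v u))\<^sup>2 / real CARD('n)"
proof -
  have "0 \<le> u \<bullet> (((1 / real CARD('n)) *\<^sub>R (transpose X ** X) - (1 / B) *\<^sub>R mat 1) *v u)"
    using assms by (simp add: design_class_def loewner_le_def psd_def)
  also have "\<dots> = u \<bullet> (transpose X *v (X *v u)) / real CARD('n) - (u \<bullet> u) / B"
    by (simp add: matrix_vector_mult_diff_rdistrib scaleR_matrix_vector_assoc [symmetric]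
        matrix_vector_mul_assoc inner_diff_right)
  also have "u \<bullet> (transpose X *v (X *v u)) = (X *v u) \<bullet> (X *v u)"
    by (metis dot_lmul_matrix vector_transpose_matrix transpose_transpose)
  finally show ?thesis
    by (simp add: power2_norm_eq_inner)
qed

text \<open>
  The vector \<open>a\<close> is row \<open>i\<close> of \<open>(X\<^sup>T X)\<^sup>-\<^sup>1 X\<^sup>T\<close>. Its norm is found by feeding \<open>a\<close> itself to least squares:
  coordinate \<open>i\<close> of the estimate \<open>u\<close> is then \<open>\<parallel>a\<parallel>\<^sup>2\<close>, whereas \<open>X u\<close> is a projection of \<open>a\<close>, so that
  \<open>\<parallel>a\<parallel>\<^sup>2 \<le> \<parallel>u\<parallel> \<le> sqrt (B / n) * \<parallel>X u\<parallel> \<le> sqrt (B / n) * \<parallel>a\<parallel>\<close>.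
\<close>

lemma ols_linear_functional:
  fixes X :: "real^'d^'n"
  assumes X: "X \<in> design_class B" and B: "B > 0"
  obtains a where "\<And>y. ols X y $ i = a \<bullet> y" "\<And>\<theta>. a \<bullet> (X *v \<theta>) = \<theta> $ i" "a \<noteq> 0"
    "(norm a)\<^sup>2 \<le> B / real CARD('n)"
proof -
  define G where "G = transpose X ** X"
  define n where "n = real CARD('n)"
  have n: "n > 0"
    by (simp add: n_def)
  have G: "u \<bullet> (G *v u) = (norm (X *v u))\<^sup>2" for u
    by (metis G_def dot_lmul_matrix vector_transpose_matrix transpose_transpose
        matrix_vector_mul_assoc power2_norm_eq_inner)
  have lower: "(norm u)\<^sup>2 \<le> B / n * (norm (X *v u))\<^sup>2" for u
    using design_class_lower_bound [OF X, of u] B n by (simp add: n_def field_simps)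
  have "\<forall>u. G *v u = 0 \<longrightarrow> u = 0"
  proof (intro allI impI)
    fix u assume "G *v u = 0"
    with G[of u] lower[of u] show "u = 0"
      by simp
  qed
  then have "invertible G"
    unfolding invertible_left_inverse by (simp add: matrix_left_invertible_ker)
  then have inv: "G ** matrix_inv G = mat 1" "matrix_inv G ** G = mat 1"
    unfolding invertible_def matrix_inv_def by (metis (mono_tags, lifting) someI_ex)+
  define a where "a = (matrix_inv G ** transpose X) $ i"
  have ols: "ols X y $ i = a \<bullet> y" for y
    by (simp add: ols_def a_def G_def matrix_vector_mult_def inner_vec_def)
  have unbiased: "a \<bullet> (X *v \<theta>) = \<theta> $ i" for \<theta>
  proof -
    have "ols X (X *v \<theta>) = (matrix_inv G ** G) *v \<theta>"
      by (simp add: ols_def G_def matrix_vector_mul_assoc matrix_mul_assoc)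
    then show ?thesis
      by (simp add: ols [symmetric] inv)
  qed
  \<comment> \<open>A normal law of variance zero has no density, so the functional must not vanish.\<close>
  have "a \<noteq> 0"
    using unbiased[of "axis i 1"] by auto
  define u where "u = ols X a"
  have "(norm (X *v u))\<^sup>2 = u \<bullet> (G *v u)"
    by (simp add: G)
  also have "G *v u = transpose X *v a"
    by (simp add: u_def ols_def G_def [symmetric] matrix_vector_mul_assoc matrix_mul_assoc inv)
  also have "u \<bullet> (transpose X *v a) = (X *v u) \<bullet> a"
    by (metis dot_lmul_matrix vector_transpose_matrix transpose_transpose)
  also have "\<dots> \<le> norm (X *v u) * norm a"
    by (rule norm_cauchy_schwarz)
  finally have Xu: "norm (X *v u) \<le> norm a"
    by (cases "norm (X *v u) = 0") (auto simp: power2_eq_square)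
  have "((norm a)\<^sup>2)\<^sup>2 = (u $ i)\<^sup>2"
    by (simp add: u_def ols power2_norm_eq_inner)
  also have "\<dots> \<le> (norm u)\<^sup>2"
    using component_le_norm_cart[of u i] by (simp add: abs_le_square_iff [symmetric])
  also have "\<dots> \<le> B / n * (norm (X *v u))\<^sup>2"
    by (rule lower)
  also have "\<dots> \<le> B / n * (norm a)\<^sup>2"
    using Xu B n by (intro mult_left_mono power_mono) auto
  finally have "(norm a)\<^sup>2 * (norm a)\<^sup>2 \<le> B / n * (norm a)\<^sup>2"
    by (simp only: power2_eq_square [of "(norm a)\<^sup>2"])
  then have "(norm a)\<^sup>2 \<le> B / n"
    by (rule mult_right_le_imp_le) (simp add: \<open>a \<noteq> 0\<close>)
  with ols unbiased \<open>a \<noteq> 0\<close> show ?thesis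
    by (intro that) (auto simp: n_def)
qed

section \<open>Linear functionals of a normal vector\<close>

text \<open>
  A sum of independent normal variables is normal. Coordinates with coefficient zero are left out of
  the sum, because a constant has no normal density.
\<close>

lemma nn_integral_linear_functional_isotropic_normal:
  fixes a \<mu> :: "real^'k"
  assumes \<sigma>: "\<sigma> > 0" and a: "a \<noteq> 0" and [measurable]: "F \<in> borel_measurable borel"
  shows "(\<integral>\<^sup>+ y. F (a \<bullet> y) \<partial>isotropic_normal \<mu> \<sigma>)
         = (\<integral>\<^sup>+ x. ennreal (normal_density (a \<bullet> \<mu>) (\<sigma> * norm a) x) * F x \<partial>lborel)"
proof -
  define N where "N = (\<lambda>i. density lborel (normal_density (\<mu> $ i) \<sigma>))"
  define M where "M = (\<Pi>\<^sub>M i\<in>UNIV. N i)"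
  define J where "J = {j. a $ j \<noteq> 0}"
  have probN: "prob_space (N i)" for i
    unfolding N_def by (rule prob_space_normal_density [OF \<sigma>])
  interpret prob_space M
    unfolding M_def by (intro prob_space_PiM probN)
  have sets_N [simp, measurable_cong]: "sets (N i) = sets borel" for i
    by (simp add: N_def)
  have coord: "(\<lambda>f. f i) \<in> M \<rightarrow>\<^sub>M N i" for i
    unfolding M_def by (rule measurable_component_singleton) simp
  have coord_borel [measurable]: "(\<lambda>f. f i) \<in> borel_measurable M" for i
    using coord[of i] by (simp cong: measurable_cong_sets)
  have marginal: "distr M borel (\<lambda>f. f i) = N i" for i
  proof -
    have "distr M borel (\<lambda>f. f i) = distr M (N i) (\<lambda>f. f i)"
      by (rule distr_cong) auto
    then show ?thesis
      unfolding M_def using distr_PiM_component [of UNIV N i] probN by simp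
  qed
  have "indep_vars (\<lambda>_. borel) (\<lambda>i f. f i) UNIV"
  proof (subst indep_vars_iff_distr_eq_PiM')
    have "sets (\<Pi>\<^sub>M i\<in>UNIV. (borel :: real measure)) = sets M"
      unfolding M_def by (intro sets_PiM_cong) auto
    then have "distr M (\<Pi>\<^sub>M i\<in>UNIV. borel) (\<lambda>f. \<lambda>i\<in>UNIV. f i) = distr M M (\<lambda>f. f)"
      by (intro distr_cong) auto
    also have "\<dots> = M"
      by (rule distr_id2) simp
    finally show "distr M (\<Pi>\<^sub>M i\<in>UNIV. borel) (\<lambda>f. \<lambda>i\<in>UNIV. f i)
                  = (\<Pi>\<^sub>M i\<in>UNIV. distr M borel (\<lambda>f. f i))"
      unfolding marginal M_def [symmetric] .
  qed auto
  then have "indep_vars (\<lambda>_. borel) (\<lambda>i f. f i) J"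
    by (rule indep_vars_subset) simp
  then have indep: "indep_vars (\<lambda>_. borel) (\<lambda>i f. a $ i * f i) J"
    by (rule indep_vars_compose2 [where Y = "\<lambda>i x. a $ i * x"]) simp
  have dist: "distributed M lborel (\<lambda>f. a $ i * f i)
        (normal_density (a $ i * \<mu> $ i) (\<bar>a $ i\<bar> * \<sigma>))" if "i \<in> J" for i
  proof -
    have "distributed M lborel (\<lambda>f. f i) (normal_density (\<mu> $ i) \<sigma>)"
      unfolding distributed_def
    proof (intro conjI)
      have "distr M lborel (\<lambda>f. f i) = distr M borel (\<lambda>f. f i)"
        by (rule distr_cong) auto
      then show "distr M lborel (\<lambda>f. f i) = density lborel (normal_density (\<mu> $ i) \<sigma>)"
        by (simp add: marginal N_def)
    qed auto
    from normal_density_affine [OF this \<sigma>, of "a $ i" 0] that show ?thesis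
      by (simp add: J_def)
  qed
  have "J \<noteq> {}"
    using a by (auto simp: J_def vec_eq_iff)
  then have "distributed M lborel (\<lambda>f. \<Sum>i\<in>J. a $ i * f i)
        (normal_density (\<Sum>i\<in>J. a $ i * \<mu> $ i) (sqrt (\<Sum>i\<in>J. (\<bar>a $ i\<bar> * \<sigma>)\<^sup>2)))"
    using \<sigma> by (intro sum_indep_normal indep dist) (auto simp: J_def)
  moreover have "(\<Sum>i\<in>J. a $ i * \<mu> $ i) = a \<bullet> \<mu>"
    unfolding inner_vec_def by (rule sum.mono_neutral_cong_left) (auto simp: J_def)
  moreover have "(\<Sum>i\<in>J. (\<bar>a $ i\<bar> * \<sigma>)\<^sup>2) = (\<sigma> * norm a)\<^sup>2"
    unfolding power_mult_distrib norm_squared_sum sum_distrib_left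
    by (rule sum.mono_neutral_cong_left) (auto simp: J_def)
  moreover have "(\<Sum>i\<in>J. a $ i * f i) = a \<bullet> (\<chi> i. f i)" for f
    unfolding inner_vec_def by (rule sum.mono_neutral_cong_left) (auto simp: J_def)
  ultimately have D: "distributed M lborel (\<lambda>f. a \<bullet> (\<chi> i. f i))
      (normal_density (a \<bullet> \<mu>) (\<sigma> * norm a))"
    using \<sigma> by simp
  have "(\<integral>\<^sup>+ y. F (a \<bullet> y) \<partial>isotropic_normal \<mu> \<sigma>) = (\<integral>\<^sup>+ f. F (a \<bullet> (\<chi> i. f i)) \<partial>M)"
    unfolding isotropic_normal_def M_def N_def
    by (rule nn_integral_distr) (auto intro: measurable_vec_lambda_PiM)
  also have "\<dots> = (\<integral>\<^sup>+ x. ennreal (normal_density (a \<bullet> \<mu>) (\<sigma> * norm a) x) * F x \<partial>lborel)"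
    by (rule distributed_nn_integral [OF D, symmetric]) simp
  finally show ?thesis .
qed

section \<open>One normal observation\<close>

text \<open>
  Completing the square turns the tilted density into a multiple of the normal density with mean
  \<open>\<theta> + t * v\<^sup>2\<close>.
\<close>

lemma normal_mgf:
  assumes "v > 0"
  shows "(\<integral>\<^sup>+ x. ennreal (normal_density \<theta> v x) * ennreal (exp (t * (x - \<theta>))) \<partial>lborel)
         = ennreal (exp (t\<^sup>2 * v\<^sup>2 / 2))"
proof -
  have "normal_density \<theta> v x * exp (t * (x - \<theta>))
        = exp (t\<^sup>2 * v\<^sup>2 / 2) * normal_density (\<theta> + t * v\<^sup>2) v x" for x
  proof -
    have "- (x - \<theta>)\<^sup>2 / (2 * v\<^sup>2) + t * (x - \<theta>)
          = t\<^sup>2 * v\<^sup>2 / 2 - (x - (\<theta> + t * v\<^sup>2))\<^sup>2 / (2 * v\<^sup>2)"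
      using assms by (simp add: field_simps power2_eq_square)
    then show ?thesis
      by (simp add: normal_density_def mult_exp_exp)
  qed
  then have "(\<integral>\<^sup>+ x. ennreal (normal_density \<theta> v x) * ennreal (exp (t * (x - \<theta>))) \<partial>lborel)
        = (\<integral>\<^sup>+ x. ennreal (exp (t\<^sup>2 * v\<^sup>2 / 2)) * ennreal (normal_density (\<theta> + t * v\<^sup>2) v x) \<partial>lborel)"
    by (simp add: ennreal_mult' [symmetric])
  also have "\<dots> = ennreal (exp (t\<^sup>2 * v\<^sup>2 / 2))"
    using assms by (simp add: nn_integral_cmult nn_integral_eq_integral)
  finally show ?thesis .
qed

text \<open>
  With noise \<open>W = x - \<theta>\<close> and \<open>c\<close> the projection onto \<open>[- \<eta>, \<eta>]\<close>, the error is \<open>W - c x\<close>. As \<open>c\<close> is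
  increasing, \<open>W * c x \<ge> W * c \<theta>\<close>, and the right-hand side has mean zero. Hence the cross term in the
  expansion of the square can only lower the risk, and no factor \<open>2\<close> is lost.
\<close>

lemma shrink_risk_le_variance_plus_threshold:
  assumes v: "v > 0" and \<eta>: "\<eta> \<ge> 0"
  shows "(\<integral>\<^sup>+ x. ennreal (normal_density \<theta> v x) * ennreal ((shrink \<eta> x - \<theta>)\<^sup>2) \<partial>lborel)
         \<le> ennreal (v\<^sup>2 + \<eta>\<^sup>2)"
proof -
  define c where "c = (\<lambda>x. max (- \<eta>) (min \<eta> x))"
  define g where "g = (\<lambda>x. normal_density \<theta> v x * (x - \<theta>)^2
    + normal_density \<theta> v x * \<eta>\<^sup>2 - 2 * c \<theta> * (normal_density \<theta> v x * (x - \<theta>)))"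
  have pointwise: "(shrink \<eta> x - \<theta>)\<^sup>2 \<le> (x - \<theta>)\<^sup>2 + \<eta>\<^sup>2 - 2 * c \<theta> * (x - \<theta>)" for x
  proof -
    have "\<bar>c x\<bar> \<le> \<bar>\<eta>\<bar>"
      using \<eta> by (auto simp: c_def)
    then have "(c x)\<^sup>2 \<le> \<eta>\<^sup>2"
      by (simp add: abs_le_square_iff)
    moreover have "0 \<le> (c x - c \<theta>) * (x - \<theta>)"
      by (cases "\<theta> \<le> x") (auto simp: c_def zero_le_mult_iff min_def max_def)
    moreover have "shrink \<eta> x - \<theta> = (x - \<theta>) - c x"
      by (simp add: shrink_def c_def)
    ultimately show ?thesis
      by (simp add: power2_diff) (simp add: algebra_simps)
  qed
  have "has_bochner_integral lborel g (v\<^sup>2 + 1 * \<eta>\<^sup>2 - 2 * c \<theta> * 0)"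
    unfolding g_def
  proof (intro has_bochner_integral_add has_bochner_integral_diff
      has_bochner_integral_mult_left has_bochner_integral_mult_right)
    show "has_bochner_integral lborel (\<lambda>x. normal_density \<theta> v x * (x - \<theta>)\<^sup>2) (v\<^sup>2)"
      using normal_moment_even [OF v, of \<theta> 1] by simp
    show "has_bochner_integral lborel (normal_density \<theta> v) 1"
      using normal_moment_even [OF v, of \<theta> 0] by simp
    show "has_bochner_integral lborel (\<lambda>x. normal_density \<theta> v x * (x - \<theta>)) 0"
      using normal_moment_odd [OF v, of \<theta> 0] by simp
  qed
  moreover have le: "normal_density \<theta> v x * (shrink \<eta> x - \<theta>)\<^sup>2 \<le> g x" for x
    using mult_left_mono [OF pointwise normal_density_nonneg, of \<theta> v x]
    by (simp add: g_def algebra_simps)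
  moreover have "0 \<le> g x" for x
    by (rule order_trans [OF _ le]) simp
  ultimately have "(\<integral>\<^sup>+ x. ennreal (g x) \<partial>lborel) = ennreal (v\<^sup>2 + \<eta>\<^sup>2)"
    by (simp add: has_bochner_integral_iff nn_integral_eq_integral)
  moreover have "(\<integral>\<^sup>+ x. ennreal (normal_density \<theta> v x) * ennreal ((shrink \<eta> x - \<theta>)\<^sup>2) \<partial>lborel)
      \<le> (\<integral>\<^sup>+ x. ennreal (g x) \<partial>lborel)"
    by (intro nn_integral_mono) (auto simp: ennreal_mult' [symmetric] intro!: ennreal_leI le)
  ultimately show ?thesis
    by simp
qed

text \<open>
  Dominating the truncated square by exponentials reduces its expectation to the moment generating
  function.
\<close>

lemma shrink_squared_le_exp:
  assumes t: "t > 0" and \<eta>: "\<eta> \<ge> 0"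
  shows "(shrink \<eta> w)\<^sup>2 \<le> 2 / t\<^sup>2 * exp (- t * \<eta>) * (exp (t * w) + exp (- t * w))"
proof -
  have tail: "u\<^sup>2 \<le> 2 / t\<^sup>2 * exp (t * u)" if "u \<ge> 0" for u
  proof -
    have "t\<^sup>2 * u\<^sup>2 / 2 \<le> 1 + t * u + t\<^sup>2 * u\<^sup>2 / 2"
      using t that by simp
    also have "\<dots> \<le> exp (t * u)"
      using exp_lower_Taylor_quadratic [of "t * u"] t that by (simp add: power_mult_distrib)
    finally show ?thesis
      using t by (simp add: field_simps)
  qed
  consider "w > \<eta>" | "w < - \<eta>" | "\<bar>w\<bar> \<le> \<eta>"
    by linarith
  then show ?thesis
  proof cases
    case 1
    then have "(shrink \<eta> w)\<^sup>2 \<le> 2 / t\<^sup>2 * exp (t * (w - \<eta>))"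
      using tail[of "w - \<eta>"] \<eta> by (simp add: shrink_def)
    also have "exp (t * (w - \<eta>)) = exp (- t * \<eta>) * exp (t * w)"
      by (simp add: mult_exp_exp algebra_simps)
    also have "2 / t\<^sup>2 * \<dots> \<le> 2 / t\<^sup>2 * (exp (- t * \<eta>) * (exp (t * w) + exp (- t * w)))"
      by (intro mult_left_mono) auto
    finally show ?thesis
      by (simp only: mult.assoc)
  next
    case 2
    then have "(shrink \<eta> w)\<^sup>2 \<le> 2 / t\<^sup>2 * exp (t * (- w - \<eta>))"
      using tail[of "- w - \<eta>"] \<eta> by (simp add: shrink_def power2_eq_square algebra_simps)
    also have "exp (t * (- w - \<eta>)) = exp (- t * \<eta>) * exp (- t * w)"
      by (simp add: mult_exp_exp algebra_simps)
    also have "2 / t\<^sup>2 * \<dots> \<le> 2 / t\<^sup>2 * (exp (- t * \<eta>) * (exp (t * w) + exp (- t * w)))"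
      by (intro mult_left_mono) auto
    finally show ?thesis
      by (simp only: mult.assoc)
  next
    case 3
    then show ?thesis
      by (simp add: shrink_def)
  qed
qed

text \<open>
  The Chernoff bound with the usual optimal exponent \<open>t = \<eta> / \<nu>\<^sup>2\<close>. The condition \<open>2 * \<nu>\<^sup>2 \<le> \<eta>\<^sup>2\<close>
  brings the factor \<open>4 / t\<^sup>2 = 4 * \<nu>\<^sup>4 / \<eta>\<^sup>2\<close> down to the order of the variance.
\<close>

lemma shrink_noise_second_moment:
  assumes v: "0 < v" "v \<le> \<nu>" and \<eta>: "\<eta> > 0" "2 * \<nu>\<^sup>2 \<le> \<eta>\<^sup>2"
  shows "(\<integral>\<^sup>+ x. ennreal (normal_density \<theta> v x) * ennreal ((shrink \<eta> (x - \<theta>))\<^sup>2) \<partial>lborel)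
         \<le> ennreal (2 * \<nu>\<^sup>2 * exp (- (\<eta>\<^sup>2 / (2 * \<nu>\<^sup>2))))"
proof -
  define t where "t = \<eta> / \<nu>\<^sup>2"
  define K where "K = 2 / t\<^sup>2 * exp (- t * \<eta>)"
  have \<nu>: "\<nu> > 0"
    using v by linarith
  have t: "t > 0"
    using \<nu> \<eta> by (simp add: t_def)
  have K: "K \<ge> 0"
    by (simp add: K_def)
  have mgf: "(\<integral>\<^sup>+ x. ennreal (normal_density \<theta> v x) * ennreal (exp (r * (x - \<theta>))) \<partial>lborel)
      = ennreal (exp (t\<^sup>2 * v\<^sup>2 / 2))" if "r = t \<or> r = - t" for r
    using that by (auto simp: normal_mgf v simp del: mult_minus_left)
  have "(\<integral>\<^sup>+ x. ennreal (normal_density \<theta> v x) * ennreal ((shrink \<eta> (x - \<theta>))\<^sup>2) \<partial>lborel)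
      \<le> (\<integral>\<^sup>+ x. ennreal K * (ennreal (normal_density \<theta> v x) * ennreal (exp (t * (x - \<theta>)))
                  + ennreal (normal_density \<theta> v x) * ennreal (exp (- t * (x - \<theta>)))) \<partial>lborel)"
  proof (intro nn_integral_mono)
    fix x
    have "normal_density \<theta> v x * (shrink \<eta> (x - \<theta>))\<^sup>2
        \<le> normal_density \<theta> v x * (K * (exp (t * (x - \<theta>)) + exp (- t * (x - \<theta>))))"
      unfolding K_def using shrink_squared_le_exp [OF t] \<eta> by (intro mult_left_mono) auto
    also have "\<dots> = K * (normal_density \<theta> v x * exp (t * (x - \<theta>))
                          + normal_density \<theta> v x * exp (- t * (x - \<theta>)))"
      by (simp only: algebra_simps)
    finally show "ennreal (normal_density \<theta> v x) * ennreal ((shrink \<eta> (x - \<theta>))\<^sup>2)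
      \<le> ennreal K * (ennreal (normal_density \<theta> v x) * ennreal (exp (t * (x - \<theta>)))
                  + ennreal (normal_density \<theta> v x) * ennreal (exp (- t * (x - \<theta>))))"
      using K by (simp add: ennreal_mult' [symmetric] ennreal_plus [symmetric] del: ennreal_plus)
  qed
  also have "\<dots> = ennreal K * (ennreal (exp (t\<^sup>2 * v\<^sup>2 / 2)) + ennreal (exp (t\<^sup>2 * v\<^sup>2 / 2)))"
    by (simp add: nn_integral_cmult nn_integral_add mgf [of t] mgf [of "- t", simplified])
  also have "\<dots> = ennreal (4 / t\<^sup>2 * exp (t\<^sup>2 * v\<^sup>2 / 2 - t * \<eta>))"
  proof -
    have "K * (exp (t\<^sup>2 * v\<^sup>2 / 2) + exp (t\<^sup>2 * v\<^sup>2 / 2)) = 4 / t\<^sup>2 * exp (t\<^sup>2 * v\<^sup>2 / 2 - t * \<eta>)"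
    proof -
      have "exp (t\<^sup>2 * v\<^sup>2 / 2 - t * \<eta>) = exp (- t * \<eta>) * exp (t\<^sup>2 * v\<^sup>2 / 2)"
        by (simp add: mult_exp_exp)
      then show ?thesis
        by (simp only: K_def) simp
    qed
    with K show ?thesis
      by (simp add: ennreal_mult' [symmetric] ennreal_plus [symmetric] del: ennreal_plus)
  qed
  also have "\<dots> \<le> ennreal (2 * \<nu>\<^sup>2 * exp (- (\<eta>\<^sup>2 / (2 * \<nu>\<^sup>2))))"
  proof (intro ennreal_leI mult_mono)
    have "4 / t\<^sup>2 = 4 * (\<nu>\<^sup>2 * \<nu>\<^sup>2) / \<eta>\<^sup>2"
      by (simp add: t_def power_divide power2_eq_square)
    also have "\<dots> \<le> 2 * \<nu>\<^sup>2"
      using mult_right_mono [OF \<eta>(2), of "\<nu>\<^sup>2"] \<eta>(1) by (simp add: field_simps)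
    finally show "4 / t\<^sup>2 \<le> 2 * \<nu>\<^sup>2" .
    have "t\<^sup>2 * v\<^sup>2 / 2 - t * \<eta> \<le> t\<^sup>2 * \<nu>\<^sup>2 / 2 - t * \<eta>"
      using v by (simp add: mult_left_mono power_mono)
    also have "\<dots> = - (\<eta>\<^sup>2 / (2 * \<nu>\<^sup>2))"
      using \<nu> by (simp add: t_def field_simps power2_eq_square)
    finally show "exp (t\<^sup>2 * v\<^sup>2 / 2 - t * \<eta>) \<le> exp (- (\<eta>\<^sup>2 / (2 * \<nu>\<^sup>2)))"
      by simp
  qed auto
  finally show ?thesis .
qed

text \<open>
  Soft thresholding is increasing and 1-Lipschitz, so thresholding \<open>x\<close> in place of \<open>x - \<theta>\<close> moves the
  result in the direction of \<open>\<theta>\<close> and by no more than \<open>\<bar>\<theta>\<bar>\<close>. The error thus exceeds the thresholded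
  noise by at most \<open>\<bar>\<theta>\<bar>\<close>, rather than by \<open>2 * \<bar>\<theta>\<bar>\<close> as the triangle inequality would give.
\<close>

lemma shrink_error_le:
  assumes "\<eta> \<ge> 0"
  shows "(shrink \<eta> x - \<theta>)\<^sup>2 \<le> 2 * (shrink \<eta> (x - \<theta>))\<^sup>2 + 2 * \<theta>\<^sup>2"
proof -
  have "\<bar>shrink \<eta> x - \<theta>\<bar> \<le> \<bar>shrink \<eta> (x - \<theta>)\<bar> + \<bar>\<theta>\<bar>"
    using assms unfolding shrink_def by (smt (verit))
  then have "(shrink \<eta> x - \<theta>)\<^sup>2 \<le> (\<bar>shrink \<eta> (x - \<theta>)\<bar> + \<bar>\<theta>\<bar>)\<^sup>2"
    by (metis abs_ge_zero power_mono power2_abs)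
  also have "\<dots> \<le> 2 * (shrink \<eta> (x - \<theta>))\<^sup>2 + 2 * \<theta>\<^sup>2"
    using sum_squares_bound [of "\<bar>shrink \<eta> (x - \<theta>)\<bar>" "\<bar>\<theta>\<bar>"] by (simp add: power2_sum)
  finally show ?thesis .
qed

text \<open>
  The two bounds on the risk meet at \<open>\<bar>\<theta>\<bar> = \<eta>\<close>: below, the signal is traded for its own size; above,
  \<open>v\<^sup>2 + \<eta>\<^sup>2 \<le> 2 * \<eta>\<^sup>2\<close>.
\<close>

lemma shrink_risk:
  assumes v: "0 < v" "v \<le> \<nu>" and \<eta>: "\<eta> > 0" "2 * \<nu>\<^sup>2 \<le> \<eta>\<^sup>2"
  shows "(\<integral>\<^sup>+ x. ennreal (normal_density \<theta> v x) * ennreal ((shrink \<eta> x - \<theta>)\<^sup>2) \<partial>lborel)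
         \<le> ennreal (4 * \<nu>\<^sup>2 * exp (- (\<eta>\<^sup>2 / (2 * \<nu>\<^sup>2))) + 2 * min (\<theta>\<^sup>2) (\<eta>\<^sup>2))"
    (is "?r \<le> ennreal (?A + _)")
proof (cases "\<theta>\<^sup>2 \<le> \<eta>\<^sup>2")
  case True
  have "?r \<le> (\<integral>\<^sup>+ x. 2 * (ennreal (normal_density \<theta> v x) * ennreal ((shrink \<eta> (x - \<theta>))\<^sup>2))
                  + ennreal (2 * \<theta>\<^sup>2) * ennreal (normal_density \<theta> v x) \<partial>lborel)"
  proof (intro nn_integral_mono)
    fix x
    have "normal_density \<theta> v x * (shrink \<eta> x - \<theta>)\<^sup>2
        \<le> 2 * (normal_density \<theta> v x * (shrink \<eta> (x - \<theta>))\<^sup>2) + 2 * \<theta>\<^sup>2 * normal_density \<theta> v x"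
      using mult_left_mono [OF shrink_error_le [of \<eta> x \<theta>] normal_density_nonneg [of \<theta> v x]] \<eta>
      by (simp add: algebra_simps)
    then show "ennreal (normal_density \<theta> v x) * ennreal ((shrink \<eta> x - \<theta>)\<^sup>2)
        \<le> 2 * (ennreal (normal_density \<theta> v x) * ennreal ((shrink \<eta> (x - \<theta>))\<^sup>2))
                  + ennreal (2 * \<theta>\<^sup>2) * ennreal (normal_density \<theta> v x)"
      by (simp add: ennreal_mult' [symmetric] ennreal_plus [symmetric]
          ennreal_numeral [symmetric] del: ennreal_plus ennreal_numeral)
  qed
  also have "\<dots> = 2 * (\<integral>\<^sup>+ x. ennreal (normal_density \<theta> v x)
        * ennreal ((shrink \<eta> (x - \<theta>))\<^sup>2) \<partial>lborel) + ennreal (2 * \<theta>\<^sup>2)"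
    using v by (simp add: nn_integral_add nn_integral_cmult nn_integral_eq_integral)
  also have "\<dots> \<le> 2 * ennreal (2 * \<nu>\<^sup>2 * exp (- (\<eta>\<^sup>2 / (2 * \<nu>\<^sup>2)))) + ennreal (2 * \<theta>\<^sup>2)"
    by (intro add_right_mono mult_left_mono shrink_noise_second_moment assms) auto
  also have "\<dots> = ennreal (?A + 2 * \<theta>\<^sup>2)"
    by (simp add: ennreal_mult' [symmetric] ennreal_plus [symmetric]
          ennreal_numeral [symmetric] del: ennreal_plus ennreal_numeral)
  finally show ?thesis
    using True by (simp add: min_def)
next
  case False
  have "v\<^sup>2 \<le> \<nu>\<^sup>2"
    using v by (intro power_mono) auto
  moreover have "0 \<le> ?A"
    by simp
  ultimately have le: "v\<^sup>2 + \<eta>\<^sup>2 \<le> ?A + 2 * \<eta>\<^sup>2"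
    using \<eta>(2) zero_le_power2[of \<nu>] by linarith
  have "?r \<le> ennreal (v\<^sup>2 + \<eta>\<^sup>2)"
    using v \<eta> by (intro shrink_risk_le_variance_plus_threshold) auto
  also have "\<dots> \<le> ennreal (?A + 2 * min (\<theta>\<^sup>2) (\<eta>\<^sup>2))"
    using le False by (intro ennreal_leI) (simp add: min_def)
  finally show ?thesis .
qed

section \<open>The risk of the estimator\<close>

lemma stols_risk:
  fixes X :: "real^'d^'n"
  assumes \<sigma>: "\<sigma> > 0" and B: "B > 0" and X: "X \<in> design_class B"
    and \<eta>: "\<eta> > 0" "2 * (\<sigma>\<^sup>2 * B / real CARD('n)) \<le> \<eta>\<^sup>2"
  shows "risk \<sigma> (stols \<eta>) X \<theta>
     \<le> ennreal (real CARD('d) * (4 * (\<sigma>\<^sup>2 * B / real CARD('n))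
                  * exp (- (\<eta>\<^sup>2 / (2 * (\<sigma>\<^sup>2 * B / real CARD('n))))))
                + 2 * (\<Sum>i\<in>UNIV. min ((\<theta> $ i)\<^sup>2) (\<eta>\<^sup>2)))"
proof -
  define \<nu> where "\<nu> = sqrt (\<sigma>\<^sup>2 * B / real CARD('n))"
  have \<nu>2: "\<nu>\<^sup>2 = \<sigma>\<^sup>2 * B / real CARD('n)"
    using B by (simp add: \<nu>_def)
  have "\<forall>i. \<exists>a. (\<forall>y. ols X y $ i = a \<bullet> y) \<and> (\<forall>\<theta>. a \<bullet> (X *v \<theta>) = \<theta> $ i) \<and> a \<noteq> 0
      \<and> (norm a)\<^sup>2 \<le> B / real CARD('n)"
    using ols_linear_functional [OF X B] by metis
  then obtain a where a: "\<And>i y. ols X y $ i = a i \<bullet> y" "\<And>i \<theta>. a i \<bullet> (X *v \<theta>) = \<theta> $ i"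
    "\<And>i. a i \<noteq> 0" "\<And>i. (norm (a i))\<^sup>2 \<le> B / real CARD('n)"
    by metis
  have sd: "\<sigma> * norm (a i) \<le> \<nu>" for i
    unfolding \<nu>_def using mult_left_mono [OF a(4)[of i], of "\<sigma>\<^sup>2"] \<sigma>
    by (intro real_le_rsqrt) (simp add: power_mult_distrib)
  have [measurable_cong]: "sets (isotropic_normal (X *v \<theta>) \<sigma>) = sets borel"
    by (simp add: isotropic_normal_def)
  have "risk \<sigma> (stols \<eta>) X \<theta> = (\<integral>\<^sup>+ y. (\<Sum>i\<in>UNIV. ennreal ((shrink \<eta> (a i \<bullet> y) - \<theta> $ i)\<^sup>2))
          \<partial>isotropic_normal (X *v \<theta>) \<sigma>)"
    using \<eta> by (simp add: risk_def stols_def norm_squared_sum soft_threshold_nth a(1) sum_ennreal)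
  also have "\<dots> = (\<Sum>i\<in>UNIV. \<integral>\<^sup>+ y. ennreal ((shrink \<eta> (a i \<bullet> y) - \<theta> $ i)\<^sup>2)
          \<partial>isotropic_normal (X *v \<theta>) \<sigma>)"
    by (rule nn_integral_sum) measurable
  also have "\<dots> = (\<Sum>i\<in>UNIV. \<integral>\<^sup>+ x. ennreal (normal_density (\<theta> $ i) (\<sigma> * norm (a i)) x)
          * ennreal ((shrink \<eta> x - \<theta> $ i)\<^sup>2) \<partial>lborel)"
    using a(2) by (intro sum.cong refl, subst nn_integral_linear_functional_isotropic_normal)
      (auto simp: \<sigma> a(3))
  also have "\<dots> \<le> (\<Sum>i\<in>UNIV. ennreal (4 * \<nu>\<^sup>2 * exp (- (\<eta>\<^sup>2 / (2 * \<nu>\<^sup>2)))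
                                      + 2 * min ((\<theta> $ i)\<^sup>2) (\<eta>\<^sup>2)))"
    using \<sigma> a(3) \<eta> by (intro sum_mono shrink_risk sd) (auto simp: \<nu>2)
  also have "\<dots> = ennreal (real CARD('d) * (4 * \<nu>\<^sup>2 * exp (- (\<eta>\<^sup>2 / (2 * \<nu>\<^sup>2))))
                + 2 * (\<Sum>i\<in>UNIV. min ((\<theta> $ i)\<^sup>2) (\<eta>\<^sup>2)))"
    by (subst sum_ennreal) (auto simp: sum.distrib sum_distrib_left)
  finally show ?thesis
    by (simp add: \<nu>2)
qed

text \<open>
  Interpolation between the two arguments of the minimum:
  \<open>min (x\<^sup>2) (\<eta>\<^sup>2) \<le> \<bar>x\<bar>\<^sup>p * \<eta>\<^bsup>2 - p\<^esup>\<close>.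
\<close>

lemma sum_min_le_lp_norm:
  assumes p: "0 < p" "p \<le> 2" and R: "lp_norm p \<theta> \<le> R" and \<eta>: "\<eta> > 0"
  shows "(\<Sum>i\<in>UNIV. min ((\<theta> $ i)\<^sup>2) (\<eta>\<^sup>2)) \<le> R powr p * \<eta> powr (2 - p)"
proof -
  have "min (x\<^sup>2) (\<eta>\<^sup>2) \<le> \<bar>x\<bar> powr p * \<eta> powr (2 - p)" for x :: real
  proof (cases "\<bar>x\<bar> \<le> \<eta>")
    case True
    have "x\<^sup>2 = \<bar>x\<bar> powr p * \<bar>x\<bar> powr (2 - p)"
      by (cases "x = 0") (auto simp: powr_add [symmetric])
    also have "\<dots> \<le> \<bar>x\<bar> powr p * \<eta> powr (2 - p)"
      using True p by (intro mult_left_mono powr_mono2) auto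
    finally show ?thesis
      by simp
  next
    case False
    have "\<eta>\<^sup>2 = \<eta> powr p * \<eta> powr (2 - p)"
      using \<eta> by (simp add: powr_add [symmetric])
    also have "\<dots> \<le> \<bar>x\<bar> powr p * \<eta> powr (2 - p)"
      using False p \<eta> by (intro mult_right_mono powr_mono2) auto
    finally show ?thesis
      by simp
  qed
  then have "(\<Sum>i\<in>UNIV. min ((\<theta> $ i)\<^sup>2) (\<eta>\<^sup>2))
      \<le> (\<Sum>i\<in>UNIV. \<bar>\<theta> $ i\<bar> powr p) * \<eta> powr (2 - p)"
    unfolding sum_distrib_right by (intro sum_mono)
  also have "(\<Sum>i\<in>UNIV. \<bar>\<theta> $ i\<bar> powr p) = lp_norm p \<theta> powr p"
    using p by (simp add: lp_norm_def powr_powr sum_nonneg)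
  also have "\<dots> \<le> R powr p"
    using p R by (intro powr_mono2) (auto simp: lp_norm_def)
  finally show ?thesis
    by (simp add: mult_right_mono)
qed

lemma sum_min_le_l0_norm:
  "(\<Sum>i\<in>UNIV. min ((\<theta> $ i)\<^sup>2) (\<eta>\<^sup>2)) \<le> real (l0_norm \<theta>) * \<eta>\<^sup>2"
proof -
  have "(\<Sum>i\<in>UNIV. min ((\<theta> $ i)\<^sup>2) (\<eta>\<^sup>2)) = (\<Sum>i\<in>{i. \<theta> $ i \<noteq> 0}. min ((\<theta> $ i)\<^sup>2) (\<eta>\<^sup>2))"
    by (rule sum.mono_neutral_right) auto
  also have "\<dots> \<le> (\<Sum>i\<in>{i. \<theta> $ i \<noteq> 0}. \<eta>\<^sup>2)"
    by (intro sum_mono) simp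
  finally show ?thesis
    by (simp add: l0_norm_def)
qed

text \<open>
  Here \<open>\<nu> = R * \<tau>\<close>. The lower bound on \<open>\<tau>\<close> says that \<open>d * \<tau>\<^sup>p \<ge> 1\<close>, which makes \<open>L \<ge> 1\<close>. In terms of the
  rate \<open>R\<^sup>2 * T\<close>, the noise costs \<open>4 / e\<close> since \<open>\<tau>\<^bsup>2 - p\<^esup> \<le> T\<close>, and the signal costs
  \<open>2 * 2\<^bsup>1 - p / 2\<^esup>\<close>.
\<close>

lemma stols_lp_risk:
  fixes X :: "real^'d^'n"
  assumes \<sigma>: "\<sigma> > 0" and B: "B > 0" and X: "X \<in> design_class B"
    and p: "0 < p" "p \<le> 2" and R: "0 < R" "lp_norm p \<theta> \<le> R"
    and \<tau>: "\<tau> = sqrt (\<sigma>\<^sup>2 * B / (R\<^sup>2 * real CARD('n)))"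
    and L: "L = ln (exp 1 * real CARD('d) * \<tau> powr p)"
    and lower: "real CARD('d) powr (- 2 / p) \<le> \<tau>\<^sup>2"
  shows "risk \<sigma> (stols (sqrt (2 * R\<^sup>2 * \<tau>\<^sup>2 * L))) X \<theta>
         \<le> ennreal (6 * R\<^sup>2 * (\<tau>\<^sup>2 * L) powr (1 - p / 2))"
proof -
  define d where "d = real CARD('d)"
  define \<eta> where "\<eta> = sqrt (2 * R\<^sup>2 * \<tau>\<^sup>2 * L)"
  have d: "d > 0"
    by (simp add: d_def)
  have \<tau>0: "\<tau> > 0"
    using \<sigma> B R by (simp add: \<tau>)
  have \<nu>2: "\<sigma>\<^sup>2 * B / real CARD('n) = R\<^sup>2 * \<tau>\<^sup>2"
    using \<sigma> B R by (simp add: \<tau>)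
  have "(d powr (- 2 / p)) powr (p / 2) \<le> (\<tau>\<^sup>2) powr (p / 2)"
    using lower p by (intro powr_mono2) (auto simp: d_def)
  moreover have "(\<tau>\<^sup>2) powr (p / 2) = \<tau> powr p"
    using \<tau>0 by (simp add: powr_powr flip: powr_numeral)
  moreover have "(d powr (- 2 / p)) powr (p / 2) = 1 / d"
  proof -
    have "- 2 / p * (p / 2) = - 1"
      using p by simp
    then show ?thesis
      using d by (simp only: powr_powr) (simp add: powr_neg_one)
  qed
  ultimately have "1 / d \<le> \<tau> powr p"
    by simp
  then have "1 \<le> d * \<tau> powr p"
    using d by (simp add: field_simps)
  then have "exp 1 \<le> exp 1 * d * \<tau> powr p"
    by (simp add: mult.assoc)
  then have L1: "L \<ge> 1"
    unfolding L d_def [symmetric] using d \<tau>0 by (subst ln_ge_iff) auto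
  have expL: "exp (- L) = 1 / (exp 1 * d * \<tau> powr p)"
    unfolding L d_def [symmetric] using d \<tau>0 by (simp add: exp_minus inverse_eq_divide)
  have \<eta>2: "\<eta>\<^sup>2 = 2 * (R\<^sup>2 * \<tau>\<^sup>2) * L"
    using L1 by (simp add: \<eta>_def)
  have \<eta>0: "\<eta> > 0"
    using L1 R \<tau>0 by (simp add: \<eta>_def)
  define T where "T = (\<tau>\<^sup>2 * L) powr (1 - p / 2)"
  have "2 - p = 2 * (1 - p / 2)"
    by simp
  then have powr_2p: "x powr (2 - p) = (x\<^sup>2) powr (1 - p / 2)" if "x > 0" for x :: real
    using that by (simp only: powr_powr [symmetric]) simp
  have "risk \<sigma> (stols \<eta>) X \<theta> \<le> ennreal (d * (4 * (R\<^sup>2 * \<tau>\<^sup>2)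
          * exp (- (\<eta>\<^sup>2 / (2 * (R\<^sup>2 * \<tau>\<^sup>2))))) + 2 * (\<Sum>i\<in>UNIV. min ((\<theta> $ i)\<^sup>2) (\<eta>\<^sup>2)))"
    using stols_risk [OF \<sigma> B X \<eta>0, of \<theta>] L1 R \<tau>0 unfolding \<nu>2 d_def by (simp add: \<eta>2)
  also have "\<dots> \<le> ennreal (2 * (R\<^sup>2 * T) + 2 * (2 * (R\<^sup>2 * T)))"
  proof (intro ennreal_leI add_mono mult_left_mono)
    have "\<tau>\<^sup>2 / \<tau> powr p = \<tau> powr (2 - p)"
      using \<tau>0 by (simp add: powr_diff)
    also have "\<dots> \<le> T"
      unfolding T_def powr_2p [OF \<tau>0] using mult_left_mono [OF L1, of "\<tau>\<^sup>2"] p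
      by (intro powr_mono2) auto
    finally have noise: "\<tau>\<^sup>2 / \<tau> powr p \<le> T" .
    have "d * (4 * (R\<^sup>2 * \<tau>\<^sup>2) * exp (- (\<eta>\<^sup>2 / (2 * (R\<^sup>2 * \<tau>\<^sup>2)))))
        = 4 / exp 1 * (R\<^sup>2 * (\<tau>\<^sup>2 / \<tau> powr p))"
      using R \<tau>0 d by (simp add: \<eta>2 expL)
    also have "\<dots> \<le> 2 * (R\<^sup>2 * T)"
      \<comment> \<open>uses \<open>2 \<le> e\<close>\<close>
      using exp_ge_add_one_self [of 1] noise
      by (intro mult_mono mult_left_mono) (auto simp: divide_le_eq)
    finally show "d * (4 * (R\<^sup>2 * \<tau>\<^sup>2) * exp (- (\<eta>\<^sup>2 / (2 * (R\<^sup>2 * \<tau>\<^sup>2))))) \<le> 2 * (R\<^sup>2 * T)" .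
    have "(\<Sum>i\<in>UNIV. min ((\<theta> $ i)\<^sup>2) (\<eta>\<^sup>2)) \<le> R powr p * \<eta> powr (2 - p)"
      by (rule sum_min_le_lp_norm) (use p R \<eta>0 in auto)
    also have "\<eta> powr (2 - p) = 2 powr (1 - p / 2) * ((R\<^sup>2) powr (1 - p / 2) * T)"
      unfolding powr_2p [OF \<eta>0] \<eta>2 T_def using L1 by (simp add: powr_mult mult.assoc)
    also have "R powr p * (2 powr (1 - p / 2) * ((R\<^sup>2) powr (1 - p / 2) * T))
        = 2 powr (1 - p / 2) * ((R powr p * R powr (2 - p)) * T)"
      by (simp add: powr_2p R)
    also have "R powr p * R powr (2 - p) = R\<^sup>2"
      using R by (simp add: powr_add [symmetric])
    also have "2 powr (1 - p / 2) * (R\<^sup>2 * T) \<le> 2 powr 1 * (R\<^sup>2 * T)"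
      using p by (intro mult_right_mono powr_mono) (auto simp: T_def)
    finally show "(\<Sum>i\<in>UNIV. min ((\<theta> $ i)\<^sup>2) (\<eta>\<^sup>2)) \<le> 2 * (R\<^sup>2 * T)"
      by simp
  qed auto
  finally show ?thesis
    by (simp add: \<eta>_def T_def mult.assoc)
qed

text \<open>
  The threshold is chosen so that \<open>d * exp (- L) = s / e\<close>: the total noise that survives in all
  coordinates costs no more than the \<open>s\<close> coordinates that carry the signal.
\<close>

lemma stols_l0_risk:
  fixes X :: "real^'d^'n"
  assumes \<sigma>: "\<sigma> > 0" and B: "B > 0" and X: "X \<in> design_class B"
    and s: "1 \<le> s" "s \<le> CARD('d)" and \<theta>: "l0_norm \<theta> \<le> s"
    and L: "L = ln (exp 1 * real CARD('d) / real s)"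
  shows "risk \<sigma> (stols (sqrt (2 * (\<sigma>\<^sup>2 * B / real CARD('n)) * L))) X \<theta>
         \<le> ennreal (6 * (\<sigma>\<^sup>2 * B / real CARD('n)) * real s * L)"
proof -
  define d where "d = real CARD('d)"
  define V where "V = \<sigma>\<^sup>2 * B / real CARD('n)"
  define \<eta> where "\<eta> = sqrt (2 * V * L)"
  have d: "d > 0"
    by (simp add: d_def)
  have V: "V > 0"
    using \<sigma> B by (simp add: V_def)
  have "exp 1 \<le> exp 1 * d / real s"
    using s by (simp add: d_def field_simps)
  then have L1: "L \<ge> 1"
    unfolding L d_def [symmetric] using d s by (subst ln_ge_iff) auto
  have expL: "exp (- L) = real s / (exp 1 * d)"
    unfolding L d_def [symmetric] using d s by (simp add: exp_minus)
  have \<eta>2: "\<eta>\<^sup>2 = 2 * V * L"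
    using L1 V by (simp add: \<eta>_def)
  have \<eta>0: "\<eta> > 0"
    using L1 V by (simp add: \<eta>_def)
  have "risk \<sigma> (stols \<eta>) X \<theta> \<le> ennreal (d * (4 * V * exp (- (\<eta>\<^sup>2 / (2 * V))))
          + 2 * (\<Sum>i\<in>UNIV. min ((\<theta> $ i)\<^sup>2) (\<eta>\<^sup>2)))"
    using stols_risk [OF \<sigma> B X \<eta>0, of \<theta>] L1 V unfolding V_def [symmetric] d_def
    by (simp add: \<eta>2)
  also have "\<dots> \<le> ennreal (2 * (V * real s * L) + 2 * (real s * (2 * V * L)))"
  proof (intro ennreal_leI add_mono mult_left_mono)
    have "d * (4 * V * exp (- (\<eta>\<^sup>2 / (2 * V)))) = 4 / exp 1 * (V * real s * 1)"
      using V d by (simp add: \<eta>2 expL)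
    also have "\<dots> \<le> 2 * (V * real s * L)"
      \<comment> \<open>uses \<open>2 \<le> e\<close>\<close>
      using exp_ge_add_one_self [of 1] V L1
      by (intro mult_mono mult_left_mono) (auto simp: divide_le_eq)
    finally show "d * (4 * V * exp (- (\<eta>\<^sup>2 / (2 * V)))) \<le> 2 * (V * real s * L)" .
    have "(\<Sum>i\<in>UNIV. min ((\<theta> $ i)\<^sup>2) (\<eta>\<^sup>2)) \<le> real (l0_norm \<theta>) * \<eta>\<^sup>2"
      by (rule sum_min_le_l0_norm)
    also have "\<dots> \<le> real s * \<eta>\<^sup>2"
      using \<theta> by (intro mult_right_mono) auto
    finally show "(\<Sum>i\<in>UNIV. min ((\<theta> $ i)\<^sup>2) (\<eta>\<^sup>2)) \<le> real s * (2 * V * L)"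
      by (simp add: \<eta>2)
  qed auto
  finally show ?thesis
    by (simp add: \<eta>_def V_def mult_ac)
qed

theorem theorem2:
  fixes \<sigma> B :: real
  assumes "CARD('d::finite) \<le> CARD('n::finite)"
    and "\<sigma> > 0" and "B > 0"
  shows
    "(\<forall>p R. 0 < p \<and> p \<le> 1 \<and> 0 < R \<longrightarrow>
       (let n = real CARD('n); d = real CARD('d);
            \<tau> = sqrt (\<sigma>\<^sup>2 * B / (R\<^sup>2 * n));
            \<eta> = sqrt (2 * R\<^sup>2 * \<tau>\<^sup>2 * ln (exp 1 * d * \<tau> powr p))
        in \<tau>\<^sup>2 \<in> {d powr (- 2 / p) .. 1 / ln (exp 1 * d)} \<longrightarrow>
           (SUP X \<in> (design_class B :: (real^'d^'n) set).
              SUP \<theta> \<in> {\<theta>. lp_norm p \<theta> \<le> R}. risk \<sigma> (stols \<eta>) X \<theta>)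
           \<le> ennreal (6 * R\<^sup>2 * (\<tau>\<^sup>2 * ln (exp 1 * d * \<tau> powr p)) powr (1 - p / 2))))
     \<and>
     (\<forall>s::nat. s \<in> {1..CARD('d)} \<longrightarrow>
       (let n = real CARD('n); d = real CARD('d);
            \<eta> = sqrt (2 * (\<sigma>\<^sup>2 * B / n) * ln (exp 1 * d / real s))
        in (SUP X \<in> (design_class B :: (real^'d^'n) set).
              SUP \<theta> \<in> {\<theta>. l0_norm \<theta> \<le> s}. risk \<sigma> (stols \<eta>) X \<theta>)
           \<le> ennreal (6 * (\<sigma>\<^sup>2 * B / n) * real s * ln (exp 1 * (d / real s)))))"
proof (intro conjI allI impI)
  fix p R :: real
  assume "0 < p \<and> p \<le> 1 \<and> 0 < R"
  then have p: "0 < p" "p \<le> 2" and R: "0 < R"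
    by auto
  show "let n = real CARD('n); d = real CARD('d);
            \<tau> = sqrt (\<sigma>\<^sup>2 * B / (R\<^sup>2 * n));
            \<eta> = sqrt (2 * R\<^sup>2 * \<tau>\<^sup>2 * ln (exp 1 * d * \<tau> powr p))
        in \<tau>\<^sup>2 \<in> {d powr (- 2 / p) .. 1 / ln (exp 1 * d)} \<longrightarrow>
           (SUP X \<in> (design_class B :: (real^'d^'n) set).
              SUP \<theta> \<in> {\<theta>. lp_norm p \<theta> \<le> R}. risk \<sigma> (stols \<eta>) X \<theta>)
           \<le> ennreal (6 * R\<^sup>2 * (\<tau>\<^sup>2 * ln (exp 1 * d * \<tau> powr p)) powr (1 - p / 2))"
    unfolding Let_def
  proof (intro impI SUP_least)
    fix X :: "real^'d^'n" and \<theta> :: "real^'d"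
    assume "(sqrt (\<sigma>\<^sup>2 * B / (R\<^sup>2 * real CARD('n))))\<^sup>2
        \<in> {real CARD('d) powr (- 2 / p) .. 1 / ln (exp 1 * real CARD('d))}"
      and X: "X \<in> design_class B" and "\<theta> \<in> {\<theta>. lp_norm p \<theta> \<le> R}"
    then have \<theta>: "lp_norm p \<theta> \<le> R"
      and lower: "real CARD('d) powr (- 2 / p) \<le> (sqrt (\<sigma>\<^sup>2 * B / (R\<^sup>2 * real CARD('n))))\<^sup>2"
      by (simp_all only: mem_Collect_eq atLeastAtMost_iff)
    show "risk \<sigma> (stols (sqrt (2 * R\<^sup>2 * (sqrt (\<sigma>\<^sup>2 * B / (R\<^sup>2 * real CARD('n))))\<^sup>2
          * ln (exp 1 * real CARD('d) * sqrt (\<sigma>\<^sup>2 * B / (R\<^sup>2 * real CARD('n))) powr p)))) X \<theta>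
        \<le> ennreal (6 * R\<^sup>2 * ((sqrt (\<sigma>\<^sup>2 * B / (R\<^sup>2 * real CARD('n))))\<^sup>2
          * ln (exp 1 * real CARD('d) * sqrt (\<sigma>\<^sup>2 * B / (R\<^sup>2 * real CARD('n))) powr p))
            powr (1 - p / 2))"
      by (rule stols_lp_risk [OF assms(2,3) X p R \<theta> refl refl lower])
  qed
next
  fix s :: nat
  assume "s \<in> {1..CARD('d)}"
  then have s: "1 \<le> s" "s \<le> CARD('d)"
    by auto
  show "let n = real CARD('n); d = real CARD('d);
            \<eta> = sqrt (2 * (\<sigma>\<^sup>2 * B / n) * ln (exp 1 * d / real s))
        in (SUP X \<in> (design_class B :: (real^'d^'n) set).
              SUP \<theta> \<in> {\<theta>. l0_norm \<theta> \<le> s}. risk \<sigma> (stols \<eta>) X \<theta>)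
           \<le> ennreal (6 * (\<sigma>\<^sup>2 * B / n) * real s * ln (exp 1 * (d / real s)))"
    unfolding Let_def times_divide_eq_right [of "exp 1"]
    by (intro SUP_least stols_l0_risk [OF assms(2,3) _ s _ refl]) (simp_all only: mem_Collect_eq)
qed

end
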